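(* Let $p$ be a prime. The polynomials $f_{m,p}(X)$ satisfy: (1) For all $m\ge 2$, $f_{m,p}(X)=X^{\theta(m-3,p)}f_{m-1,p}(X)+f_{m-2,p}(X)$. (2) For all $m\ge1$, every coefficient of $f_{m,p}(X)$ is $0$ or $1$; i.e. $f_{m,p}(X)=\sum_{i\in S(m,p)}X^i$ where $S(m,p)$ is the set of exponents $i\in\mathbb{N}$ whose coefficient in $f_{m,p}$ is nonzero. (3) For all $m\ge1$, the number of terms of $f_{m,p}(X)$, i.e. $\#S(m,p)$, equals the Fibonacci number $\mathrm{Fib}(m)$. (4) For all $m,n\ge 1$, $\gcd(f_{m,p}(X),f_{n,p}(X))=f_{\gcd(m,n),p}(X)$. (5) If $m\ge1$ is odd and $i\in S(m,p)$, then the base $(-p)$ expansion of $i$ involves only the digits $0$ and $1$. (6) If $m\ge 2$ is even and $i\in S(m,p)$, then the base $(-p)$ expansion of $-i$ involves only the digits $0$ and $1$. (7) For all $m\ge1$, $S(m,p)\subseteq S(m+2,p)$.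
   Context: Let $\mathbb{F}$ be an algebraic closure of $\mathbb{F}_p$. For $x,y\in\mathbb{F}$ and integers $i,j\ge0$ write $[i,j]:=x^{p^i}y^{p^j}-x^{p^j}y^{p^i}$. For $x,y\in\mathbb{F}$ linearly independent over $\mathbb{F}_p$ let $\nu(x,y):=-\dfrac{[0,2][1,3]}{[0,1][2,3]}$. For $m\ge1$ let $\mathcal{Z}(m)=\{\nu(x,y): x,y\in\mathbb{F}_{p^m}\text{ linearly independent over }\mathbb{F}_p\}$, $\mathcal{Z}^\circ(m)=\mathcal{Z}(m)\setminus\{0\}$, and $f_{m,p}(X):=\prod_{z\in\mathcal{Z}^\circ(m)}(X-z)$ (so $f_{1,p}=f_{2,p}=1$); also set $f_{0,p}:=0$. For an integer $r\ge 0$, $\theta(r,p):=p^r-p^{r-1}+\cdots+(-1)^r=\sum_{i=0}^{r}(-1)^{r-i}p^i$, and $\theta(-1,p):=0$. Fibonacci numbers: $\mathrm{Fib}(0)=0,\mathrm{Fib}(1)=1,\mathrm{Fib}(n)=\mathrm{Fib}(n-1)+\mathrm{Fib}(n-2)$. The base $(-p)$ expansion of an integer $n$ is its unique representation $n=\sum_{j}d_j(-p)^j$ with digits $d_j\in\{0,1,\dots,p-1\}$, almost all zero. gcd of polynomials is taken monic. *)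

theory Defs
  imports "HOL-Computational_Algebra.Computational_Algebra" "HOL-Number_Theory.Cong" "HOL-Number_Theory.Fib"
begin

section \<open>Finite subfields of an algebraic closure of a prime field\<close>

definition prime_subfield :: "'a :: field set" where
  "prime_subfield = range of_int"

text \<open>
  The algebraically closed field \<open>'a\<close> is an algebraic closure of the field with \<open>p\<close> elements:
  it has characteristic \<open>p\<close> and is algebraic over its prime subfield.
  (\<open>algebraic\<close> from the library is restricted to characteristic 0.)
\<close>
definition is_alg_closure_Fp :: "'a :: alg_closed_field itself \<Rightarrow> nat \<Rightarrow> bool" where
  "is_alg_closure_Fp _ p \<longleftrightarrow> CHAR('a) = p \<and>
     (\<forall>x :: 'a. \<exists>q. q \<noteq> 0 \<and> (\<forall>i. coeff q i \<in> prime_subfield) \<and> poly q x = 0)"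

text \<open>
  For \<open>m \<ge> 1\<close> this is the subfield with \<open>p ^ m\<close> elements: see \<open>finite_subfield_closed\<close>,
  \<open>card_finite_subfield\<close> and \<open>finite_subfield_unique\<close> below.  For \<open>m = 1\<close> it is the
  prime subfield (\<open>prime_subfield_eq_finite_subfield\<close>).
\<close>
definition finite_subfield :: "nat \<Rightarrow> nat \<Rightarrow> 'a :: field set" where
  "finite_subfield p m = {x. x ^ (p ^ m) = x}"

definition lin_indep_Fp :: "'a :: field \<Rightarrow> 'a \<Rightarrow> bool" where
  "lin_indep_Fp x y \<longleftrightarrow>
     (\<forall>a\<in>prime_subfield. \<forall>b\<in>prime_subfield. a * x + b * y = 0 \<longrightarrow> a = 0 \<and> b = 0)"

lemma finite_subfield_closed:
  fixes x y :: "'a :: field"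
  assumes p: "prime p" "CHAR('a) = p"
  shows "0 \<in> (finite_subfield p m :: 'a set)" "1 \<in> (finite_subfield p m :: 'a set)"
    and "x \<in> finite_subfield p m \<Longrightarrow> y \<in> finite_subfield p m \<Longrightarrow> x + y \<in> finite_subfield p m"
    and "x \<in> finite_subfield p m \<Longrightarrow> y \<in> finite_subfield p m \<Longrightarrow> x * y \<in> finite_subfield p m"
    and "x \<in> finite_subfield p m \<Longrightarrow> - x \<in> finite_subfield p m"
    and "x \<in> finite_subfield p m \<Longrightarrow> inverse x \<in> finite_subfield p m"
proof -
  have p0: "p ^ m > 0"
    using prime_gt_0_nat[OF p(1)] by simp
  show 0: "0 \<in> (finite_subfield p m :: 'a set)" and "1 \<in> (finite_subfield p m :: 'a set)"
    using p0 by (auto simp: finite_subfield_def)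
  have fd: "(u + v) ^ (p ^ m) = u ^ (p ^ m) + v ^ (p ^ m)" for u v :: 'a
    by (rule freshmans_dream'[where n = m]) (use p in auto)
  show "x \<in> finite_subfield p m \<Longrightarrow> y \<in> finite_subfield p m \<Longrightarrow> x + y \<in> finite_subfield p m"
    by (simp add: finite_subfield_def fd)
  show "x \<in> finite_subfield p m \<Longrightarrow> y \<in> finite_subfield p m \<Longrightarrow> x * y \<in> finite_subfield p m"
    by (simp add: finite_subfield_def power_mult_distrib)
  show "x \<in> finite_subfield p m \<Longrightarrow> - x \<in> finite_subfield p m"
    using fd[of x "- x"] p0
    by (simp add: finite_subfield_def zero_power eq_neg_iff_add_eq_0 add.commute)
  show "x \<in> finite_subfield p m \<Longrightarrow> inverse x \<in> finite_subfield p m"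
    by (simp add: finite_subfield_def power_inverse)
qed

lemma card_finite_subfield:
  assumes p: "prime p" "CHAR('a :: alg_closed_field) = p" and m: "m \<ge> 1"
  shows "card (finite_subfield p m :: 'a set) = p ^ m"
proof -
  define q where "q = p ^ m"
  have q: "q > 1"
    using p(1) m unfolding q_def by (metis not_one_le_zero neq0_conv one_less_power prime_gt_1_nat)
  define P :: "'a poly" where "P = monom 1 q - [:0, 1:]"
  have "degree (monom (1 :: 'a) q + (- [:0, 1:])) = q"
    using q by (subst degree_add_eq_left) (auto simp: degree_monom_eq)
  hence degP: "degree P = q"
    unfolding P_def by (simp only: diff_conv_add_uminus)
  hence P0: "P \<noteq> 0" using q by auto
  have "of_nat q = (0 :: 'a)"
    using p m by (auto simp: of_nat_eq_0_iff_char_dvd q_def)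
  hence deriv: "pderiv P = - 1"
    by (simp add: P_def pderiv_diff pderiv_monom pderiv_pCons one_pCons)
  obtain A where A: "size A = degree P" "P = smult (lead_coeff P) (\<Prod>x\<in>#A. [:- x, 1:])"
    using alg_closed_imp_factorization[OF P0] by metis
  have roots: "{x. poly P x = 0} = set_mset A"
    using P0 by (subst A(2)) (auto simp: poly_prod_mset)
  have "count A x \<le> 1" for x
  proof (rule ccontr)
    assume "\<not> count A x \<le> 1"
    hence "{#x, x#} \<subseteq># A"
      by (auto simp: subseteq_mset_def)
    then obtain B where "A = {#x, x#} + B"
      by (auto simp: subset_mset.le_iff_add)
    hence "(\<Prod>x\<in>#A. [:- x, 1:]) = [:- x, 1:] ^ 2 * (\<Prod>x\<in>#B. [:- x, 1:])"
      by (simp only: power2_eq_square) (simp del: mult_pCons_left)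
    hence "[:- x, 1:] ^ 2 dvd P"
      by (subst A(2)) (simp only: dvd_smult dvd_triv_left)
    then obtain r where "P = [:- x, 1:] ^ 2 * r" ..
    hence "P = [:- x, 1:] * ([:- x, 1:] * r)"
      by (simp only: power2_eq_square mult.assoc)
    hence "poly (pderiv P) x = 0"
      by (simp only: pderiv_mult poly_add poly_mult) simp
    thus False by (simp add: deriv)
  qed
  hence "count A x = 1" if "x \<in># A" for x
    using that by (metis One_nat_def Suc_leI count_greater_zero_iff le_antisym)
  hence "mset_set (set_mset A) = A"
    by (intro multiset_eqI) (simp add: count_mset_set' not_in_iff)
  hence "card (set_mset A) = q"
    using A(1) degP by (metis size_mset_set)
  moreover have "finite_subfield p m = {x. poly P x = 0}"
    by (auto simp: finite_subfield_def P_def poly_monom q_def)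
  ultimately show ?thesis
    by (simp add: roots q_def)
qed

lemma finite_subfield_unique:
  fixes K :: "'a :: alg_closed_field set"
  assumes p: "prime p" "CHAR('a) = p" and m: "m \<ge> 1"
    and K: "card K = p ^ m" "0 \<in> K" "\<And>x y. x \<in> K \<Longrightarrow> y \<in> K \<Longrightarrow> x * y \<in> K"
  shows "K = finite_subfield p m"
proof -
  have fin: "finite K"
    using K(1) prime_gt_0_nat[OF p(1)] by (intro card_ge_0_finite) auto
  have "x ^ (p ^ m) = x" if x: "x \<in> K" for x
  proof (cases "x = 0")
    case True
    thus ?thesis using prime_gt_0_nat[OF p(1)] by simp
  next
    case False
    let ?L = "K - {0}"
    have "(\<lambda>y. x * y) ` ?L \<subseteq> ?L"
      using K(3) x False by auto
    moreover have inj: "inj_on (\<lambda>y. x * y) ?L"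
      using False by (auto simp: inj_on_def)
    ultimately have im: "(\<lambda>y. x * y) ` ?L = ?L"
      using fin by (meson endo_inj_surj finite_Diff)
    have "prod id ?L = prod id ((\<lambda>y. x * y) ` ?L)"
      by (simp only: im)
    also have "\<dots> = (\<Prod>y\<in>?L. x * y)"
      using inj by (simp add: prod.reindex)
    also have "\<dots> = x ^ card ?L * prod id ?L"
      by (simp add: prod.distrib)
    finally have "x ^ card ?L = 1"
      using fin by auto
    moreover have "p ^ m = Suc (card ?L)"
      using K(1,2) fin by (metis card.remove)
    ultimately show ?thesis by simp
  qed
  hence "K \<subseteq> finite_subfield p m"
    by (auto simp: finite_subfield_def)
  moreover have "card (finite_subfield p m :: 'a set) = p ^ m"
    using p m by (rule card_finite_subfield)
  moreover from this have "finite (finite_subfield p m :: 'a set)"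
    using prime_gt_0_nat[OF p(1)] by (intro card_ge_0_finite) auto
  ultimately show ?thesis
    using K(1) by (intro card_subset_eq) auto
qed

lemma prime_subfield_eq_finite_subfield:
  assumes p: "prime p" "CHAR('a :: alg_closed_field) = p"
  shows "(prime_subfield :: 'a set) = finite_subfield p 1"
proof (rule finite_subfield_unique[OF p])
  have "(prime_subfield :: 'a set) = of_int ` {0..<int p}"
  proof -
    have "(of_int k :: 'a) = of_int (k mod int p)" for k
      using p by (simp add: of_int_eq_iff_cong_CHAR cong_def)
    moreover have "k mod int p \<in> {0..<int p}" for k
      using prime_gt_0_nat[OF p(1)] by simp
    ultimately show ?thesis
      unfolding prime_subfield_def by blast
  qed
  moreover have "inj_on (of_int :: int \<Rightarrow> 'a) {0..<int p}"
    using p by (auto simp: inj_on_def of_int_eq_iff_cong_CHAR cong_def)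
  ultimately have "card (prime_subfield :: 'a set) = card {0..<int p}"
    by (metis card_image)
  thus "card (prime_subfield :: 'a set) = p ^ 1"
    by simp
  show "(0 :: 'a) \<in> prime_subfield"
    unfolding prime_subfield_def by (metis of_int_0 rangeI)
  show "x * y \<in> prime_subfield" if "x \<in> prime_subfield" "y \<in> prime_subfield" for x y :: 'a
    using that unfolding prime_subfield_def by (metis (no_types) of_int_mult rangeE rangeI)
qed simp

section \<open>The polynomials\<close>

definition bracket :: "nat \<Rightarrow> 'a :: field \<Rightarrow> 'a \<Rightarrow> nat \<Rightarrow> nat \<Rightarrow> 'a" where
  "bracket p x y i j = x ^ (p ^ i) * y ^ (p ^ j) - x ^ (p ^ j) * y ^ (p ^ i)"

definition nu :: "nat \<Rightarrow> 'a :: field \<Rightarrow> 'a \<Rightarrow> 'a" where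
  "nu p x y = - (bracket p x y 0 2 * bracket p x y 1 3) / (bracket p x y 0 1 * bracket p x y 2 3)"

definition Zset :: "nat \<Rightarrow> nat \<Rightarrow> 'a :: field set" where
  "Zset m p = {nu p x y | x y.
     x \<in> finite_subfield p m \<and> y \<in> finite_subfield p m \<and> lin_indep_Fp x y}"

definition Zset0 :: "nat \<Rightarrow> nat \<Rightarrow> 'a :: field set" where
  "Zset0 m p = Zset m p - {0}"

definition fpoly :: "nat \<Rightarrow> nat \<Rightarrow> 'a :: field poly" where
  "fpoly m p = (if m = 0 then 0 else (\<Prod>z\<in>Zset0 m p. [:- z, 1:]))"

definition exponents :: "'a :: field itself \<Rightarrow> nat \<Rightarrow> nat \<Rightarrow> nat set" where
  "exponents _ m p = {i. coeff (fpoly m p :: 'a poly) i \<noteq> 0}"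

text \<open>
  The product defining \<^const>\<open>fpoly\<close> does not degenerate: the index set is finite.
\<close>
lemma finite_Zset:
  assumes p: "prime p" "CHAR('a :: alg_closed_field) = p" and m: "m \<ge> 1"
  shows "finite (Zset m p :: 'a set)"
proof -
  let ?K = "finite_subfield p m :: 'a set"
  have "finite ?K"
    using card_finite_subfield[OF p m] prime_gt_0_nat[OF p(1)] by (intro card_ge_0_finite) auto
  hence "finite ((\<lambda>(x, y). nu p x y) ` (?K \<times> ?K))"
    by simp
  moreover have "(Zset m p :: 'a set) \<subseteq> (\<lambda>(x, y). nu p x y) ` (?K \<times> ?K)"
    by (auto simp: Zset_def)
  ultimately show ?thesis
    by (rule finite_subset[rotated])
qed

section \<open>Alternating sums and expansions in base \<open>- p\<close>\<close>

definition theta :: "int \<Rightarrow> nat \<Rightarrow> int" where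
  "theta r p = (if r < 0 then 0 else (\<Sum>i=0..nat r. (- 1) ^ (nat r - i) * int p ^ i))"

text \<open>So applying \<^const>\<open>nat\<close> to \<^const>\<open>theta\<close> loses nothing.\<close>
lemma theta_nonneg:
  assumes "p \<ge> 1"
  shows "theta r p \<ge> 0"
proof (cases "r < 0")
  case False
  define T where "T n = (\<Sum>i=0..n. (- 1) ^ (n - i) * int p ^ i)" for n
  have T_Suc: "T (Suc n) = int p ^ Suc n - T n" for n
  proof -
    have "T (Suc n) = (\<Sum>i=0..n. (- 1) ^ (Suc n - i) * int p ^ i) + int p ^ Suc n"
      by (simp add: T_def)
    also have "(\<Sum>i=0..n. (- 1) ^ (Suc n - i) * int p ^ i) = (\<Sum>i=0..n. - ((- 1) ^ (n - i) * int p ^ i))"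
      by (intro sum.cong) (auto simp: Suc_diff_le)
    finally show ?thesis by (simp add: T_def sum_negf)
  qed
  have "0 \<le> T n \<and> T n \<le> int p ^ n" for n
  proof (induction n)
    case (Suc n)
    have "int p ^ n \<le> int p ^ Suc n"
      using assms by (intro power_increasing) auto
    thus ?case
      using Suc.IH unfolding T_Suc by auto
  qed (simp add: T_def)
  thus ?thesis
    using False by (simp add: theta_def T_def)
qed (simp add: theta_def)

definition is_negabase_expansion :: "nat \<Rightarrow> int \<Rightarrow> (nat \<Rightarrow> nat) \<Rightarrow> bool" where
  "is_negabase_expansion p n d \<longleftrightarrow>
     (\<forall>j. d j < p) \<and> finite {j. d j \<noteq> 0} \<and> n = (\<Sum>j | d j \<noteq> 0. int (d j) * (- int p) ^ j)"

definition negabase_digits :: "nat \<Rightarrow> int \<Rightarrow> nat \<Rightarrow> nat" where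
  "negabase_digits p n = (THE d. is_negabase_expansion p n d)"

lemma is_negabase_expansion_altdef:
  "is_negabase_expansion p n d \<longleftrightarrow> (\<forall>j. d j < p) \<and>
     (\<exists>N. (\<forall>j\<ge>N. d j = 0) \<and> n = (\<Sum>j<N. int (d j) * (- int p) ^ j))"
proof -
  have eq: "(\<Sum>j | d j \<noteq> 0. int (d j) * (- int p) ^ j) = (\<Sum>j<N. int (d j) * (- int p) ^ j)"
    if "\<forall>j\<ge>N. d j = 0" for N
  proof (intro sum.mono_neutral_left)
    show "{j. d j \<noteq> 0} \<subseteq> {..<N}"
      using that by (metis (mono_tags, lifting) lessThan_iff mem_Collect_eq not_le subsetI)
  qed auto
  have fin: "finite {j. d j \<noteq> 0} \<longleftrightarrow> (\<exists>N. \<forall>j\<ge>N. d j = 0)"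
    unfolding finite_nat_set_iff_bounded by (metis (mono_tags, lifting) mem_Collect_eq not_le)
  have "(\<exists>N. \<forall>j\<ge>N. d j = 0) \<and> n = (\<Sum>j | d j \<noteq> 0. int (d j) * (- int p) ^ j) \<longleftrightarrow>
      (\<exists>N. (\<forall>j\<ge>N. d j = 0) \<and> n = (\<Sum>j<N. int (d j) * (- int p) ^ j))"
    by (simp only: ex_simps(1)[symmetric]) (use eq in \<open>blast intro: trans sym\<close>)
  thus ?thesis
    unfolding is_negabase_expansion_def fin by blast
qed

lemma negabase_expansion_exists:
  assumes p: "p \<ge> 2"
  shows "\<exists>d. is_negabase_expansion p n d"
proof (induction "2 * nat \<bar>n\<bar> + (if n < 0 then 1 else 0)" arbitrary: n rule: less_induct)
  case less
  show ?case
  proof (cases "n = 0")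
    case True
    show ?thesis
      using p True by (intro exI[of _ "\<lambda>_. 0"]) (auto simp: is_negabase_expansion_def)
  next
    case False
    define k where "k = - (n div int p)"
    define r where "r = nat (n mod int p)"
    have n: "n = int r + (- int p) * k"
      using p by (simp add: k_def r_def)
    have r: "r < p"
      using p by (simp add: r_def nat_less_iff)
    have "2 * nat \<bar>k\<bar> + (if k < 0 then 1 else 0) < 2 * nat \<bar>n\<bar> + (if n < 0 then 1 else 0)"
    proof (cases "n > 0")
      case True
      have "n div int p \<ge> 0" "n div int p \<le> n div 2"
        using True p by (auto intro: zdiv_mono2 simp: pos_imp_zdiv_nonneg_iff)
      thus ?thesis
        using True unfolding k_def by auto
    next
      case neg: False
      hence "n < 0" using False by simp
      hence "n div int p < 0" "n div int p \<ge> n div 2"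
        using p by (auto intro: zdiv_mono2_neg simp: neg_imp_zdiv_neg_iff div_neg_pos_less0)
      thus ?thesis
        using \<open>n < 0\<close> unfolding k_def by auto
    qed
    from less[OF this] obtain d N where d: "\<forall>j. d j < p" "\<forall>j\<ge>N. d j = 0"
        "k = (\<Sum>j<N. int (d j) * (- int p) ^ j)"
      unfolding is_negabase_expansion_altdef by blast
    define e where "e j = (case j of 0 \<Rightarrow> r | Suc i \<Rightarrow> d i)" for j
    have "(\<Sum>j<Suc N. int (e j) * (- int p) ^ j) =
            int r + (\<Sum>j<N. int (d j) * (- int p) ^ Suc j)"
      by (subst sum.lessThan_Suc_shift) (simp add: e_def)
    also have "(\<Sum>j<N. int (d j) * (- int p) ^ Suc j) = (- int p) * k"
      unfolding d(3) sum_distrib_left by (intro sum.cong) auto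
    finally have "n = (\<Sum>j<Suc N. int (e j) * (- int p) ^ j)"
      using n by simp
    moreover have "\<forall>j. e j < p" "\<forall>j\<ge>Suc N. e j = 0"
      using d r by (auto simp: e_def split: nat.splits)
    ultimately show ?thesis
      unfolding is_negabase_expansion_altdef by blast
  qed
qed

lemma negabase_expansion_unique:
  assumes "is_negabase_expansion p n d" "is_negabase_expansion p n e"
  shows "d = e"
proof -
  have *: "\<forall>j<N. d j = e j"
    if "\<forall>j. d j < p" "\<forall>j. e j < p"
      "(\<Sum>j<N. int (d j) * (- int p) ^ j) = (\<Sum>j<N. int (e j) * (- int p) ^ j)"
    for d e :: "nat \<Rightarrow> nat" and N
    using that
  proof (induction N arbitrary: d e)
    case (Suc N)
    have p: "p > 0" using Suc.prems(1) by (metis gr0I not_less0)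
    have split: "(\<Sum>j<Suc N. int (f j) * (- int p) ^ j) =
        int (f 0) + int p * - (\<Sum>j<N. int (f (Suc j)) * (- int p) ^ j)" for f
      by (subst sum.lessThan_Suc_shift)
         (simp add: sum_distrib_left algebra_simps flip: sum_negf)
    let ?S = "\<lambda>f. (\<Sum>j<N. int (f (Suc j)) * (- int p) ^ j)"
    have eq: "int (d 0) + int p * - ?S d = int (e 0) + int p * - ?S e"
      using Suc.prems(3) unfolding split .
    hence "(int (d 0) + int p * - ?S d) mod int p = (int (e 0) + int p * - ?S e) mod int p"
      by simp
    hence 0: "d 0 = e 0"
      using Suc.prems(1,2) by (simp only: mod_mult_self2) simp
    hence S: "?S d = ?S e"
      using eq p by simp
    have "\<forall>j<N. d (Suc j) = e (Suc j)"
      by (rule Suc.IH[OF _ _ S]) (use Suc.prems(1,2) in blast)+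
    with 0 show ?case
      by (auto simp: less_Suc_eq_0_disj)
  qed simp
  have extend: "(\<Sum>j<N. int (f j) * (- int p) ^ j) = (\<Sum>j<M. int (f j) * (- int p) ^ j)"
    if "\<forall>j\<ge>N. f j = 0" "N \<le> M" for f N M
    using that by (intro sum.mono_neutral_left) auto
  obtain N1 N2 where N: "\<forall>j. d j < p" "\<forall>j\<ge>N1. d j = 0" "n = (\<Sum>j<N1. int (d j) * (- int p) ^ j)"
      "\<forall>j. e j < p" "\<forall>j\<ge>N2. e j = 0" "n = (\<Sum>j<N2. int (e j) * (- int p) ^ j)"
    using assms unfolding is_negabase_expansion_altdef by blast
  define M where "M = max N1 N2"
  have "\<forall>j<M. d j = e j"
    using N extend[of N1 d M] extend[of N2 e M] by (intro *) (auto simp: M_def)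
  moreover have "\<forall>j\<ge>M. d j = e j"
    using N by (auto simp: M_def)
  ultimately show ?thesis
    by (intro ext) (metis not_le)
qed

lemma is_negabase_expansion_negabase_digits:
  assumes "p \<ge> 2"
  shows "is_negabase_expansion p n (negabase_digits p n)"
proof -
  have "\<exists>!d. is_negabase_expansion p n d"
    using negabase_expansion_exists[OF assms] negabase_expansion_unique by blast
  thus ?thesis
    unfolding negabase_digits_def by (rule theI')
qed

end

theory Submission
  imports Defs
begin

text \<open>
  Let \<open>F\<^sub>m\<close> be the polynomials defined by the recurrence.  The Pluecker relation
  \<open>[0,m][m+1,m+2] - [0,m+1][m,m+2] + [0,m+2][m,m+1] = 0\<close> and \<open>[i+k,j+k] = [i,j] ^ (p ^ k)\<close> give a
  three-term recurrence for the \<open>[0,m]\<close>, from which \<open>[0,m] = c\<^sub>m F\<^sub>m(\<nu>(x,y))\<close> with \<open>c\<^sub>m \<noteq> 0\<close> whenever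
  \<open>\<nu>(x,y) \<noteq> 0\<close>.  Since \<open>[0,m] = 0\<close> says that \<open>x / y\<close> lies in the field with \<open>p ^ m\<close> elements,
  the elements of \<open>\<Z>\<^sup>\<circ>(m)\<close> are roots of \<open>F\<^sub>m\<close>.  As \<open>t \<mapsto> \<nu>(t,1)\<close> is a rational function of degree
  \<open>p ^ 3 - p\<close>, there are at least \<open>(p ^ m - p ^ gcd m 2) / (p ^ 3 - p) = deg F\<^sub>m\<close> of them, so
  \<open>f\<^sub>m = F\<^sub>m\<close>.  The combinatorial claims follow from the recurrence, because
  \<open>deg F\<^sub>m < \<theta>(m - 1)\<close> rules out overlaps and because \<open>\<theta>(r) = \<plusminus>\<Sum>\<^sub>i\<^sub>\<le>\<^sub>r (-p) ^ i\<close> turns a shift by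
  \<open>\<theta>\<close> into complementing the digits \<open>0\<close> and \<open>1\<close>.
\<close>

section \<open>The recurrence and its degrees\<close>

text \<open>Indexed by the polynomial that the shift helps to build. The value at
  \<open>m = 2\<close> is 0 through the convention \<theta>(-1) = 0.\<close>

definition fib_shift :: "nat \<Rightarrow> nat \<Rightarrow> nat" where
  "fib_shift p m = nat (theta (int m - 3) p)"

fun fib_poly :: "nat \<Rightarrow> nat \<Rightarrow> 'a :: comm_ring_1 poly" where
  "fib_poly p 0 = 0"
| "fib_poly p (Suc 0) = 1"
| "fib_poly p (Suc (Suc m)) =
     monom 1 (fib_shift p (Suc (Suc m))) * fib_poly p (Suc m) + fib_poly p m"

lemma theta_Suc: "theta (int (Suc n)) p = int p ^ Suc n - theta (int n) p"
proof -
  have "theta (int (Suc n)) p = (\<Sum>i=0..n. (- 1) ^ (Suc n - i) * int p ^ i) + int p ^ Suc n"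
    by (simp add: theta_def nat_add_distrib)
  also have "(\<Sum>i=0..n. (- 1) ^ (Suc n - i) * int p ^ i) =
      (\<Sum>i=0..n. - ((- 1) ^ (n - i) * int p ^ i))"
    by (intro sum.cong) (auto simp: Suc_diff_le)
  finally show ?thesis by (simp add: theta_def sum_negf)
qed

lemma theta_eq_negabase_sum: "theta (int n) p = (- 1) ^ n * (\<Sum>j<Suc n. (- int p) ^ j)"
proof (induction n)
  case (Suc n)
  have "(- 1) ^ Suc n * (- int p) ^ Suc n = int p ^ Suc n"
    by (simp flip: power_mult_distrib)
  thus ?case
    by (simp only: theta_Suc Suc.IH sum.lessThan_Suc[of _ "Suc n"] distrib_left)
       (simp add: algebra_simps)
qed (simp add: theta_def)

lemma fib_shift_less_3 [simp]: "m < 3 \<Longrightarrow> fib_shift p m = 0"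
  by (simp add: fib_shift_def theta_def)

text \<open>Adding consecutive alternating sums leaves only the top power. For \<open>k = 0\<close>
  this again rests on \<theta>(-1) = 0.\<close>

lemma fib_shift_add:
  assumes "p \<ge> 1"
  shows "fib_shift p (k + 3) + fib_shift p (k + 2) = p ^ k"
proof (cases k)
  case 0
  thus ?thesis by (simp add: fib_shift_def theta_def)
next
  case (Suc n)
  have "int (fib_shift p (k + 3)) = theta (int (Suc n)) p"
       "int (fib_shift p (k + 2)) = theta (int n) p"
    using theta_nonneg[OF assms] by (simp_all add: fib_shift_def Suc)
  hence "int (fib_shift p (k + 3) + fib_shift p (k + 2)) = int (p ^ k)"
    using Suc by (simp add: theta_Suc del: of_nat_Suc)
  thus ?thesis
    by (simp only: of_nat_eq_iff)
qed

fun fib_deg :: "nat \<Rightarrow> nat \<Rightarrow> nat" where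
  "fib_deg p 0 = 0"
| "fib_deg p (Suc m) = fib_shift p (Suc m) + fib_deg p m"

lemma fib_deg_add2:
  assumes "p \<ge> 1"
  shows "fib_deg p (k + 3) = p ^ k + fib_deg p (k + 1)"
  using fib_shift_add[OF assms, of k] by (simp add: numeral_3_eq_3)

text \<open>In steps of two the left side grows by p^n, while the right side grows by p^(n+2) -
  p^(n+1), which is at least 2 p^n.\<close>

lemma fib_deg_less_fib_shift:
  assumes "p \<ge> 2"
  shows "fib_deg p (k + 1) < fib_shift p (k + 3)"
proof (induction k rule: less_induct)
  case (less k)
  consider "k = 0" | "k = 1" | n where "k = n + 2"
    by (metis One_nat_def add_2_eq_Suc' nat.exhaust)
  thus ?case
  proof cases
    case 1
    thus ?thesis using fib_shift_add[of p 0] assms by simp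
  next
    case 2
    thus ?thesis
      using fib_shift_add[of p 0] fib_shift_add[of p 1] assms by (simp add: eval_nat_numeral)
  next
    case 3
    have "fib_deg p (k + 1) = p ^ n + fib_deg p (n + 1)"
      using fib_deg_add2[of p n] assms 3 by (simp add: eval_nat_numeral)
    moreover have "fib_deg p (n + 1) < fib_shift p (n + 3)"
      by (rule less) (simp add: 3)
    moreover have "fib_shift p (n + 5) + fib_shift p (n + 4) = p ^ (n + 2)"
        "fib_shift p (n + 4) + fib_shift p (n + 3) = p ^ (n + 1)"
      using fib_shift_add[of p "n + 2"] fib_shift_add[of p "n + 1"] assms
      by (simp_all add: eval_nat_numeral)
    moreover have "2 * p ^ (n + 1) \<le> p ^ (n + 2)" "2 * p ^ n \<le> p ^ (n + 1)"
      using assms by simp_all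
    moreover have "p ^ n > 0" using assms by simp
    ultimately have "fib_deg p (k + 1) < fib_shift p (n + 5)"
      by linarith
    thus ?thesis
      using 3 by (simp add: add.commute)
  qed
qed

text \<open>Telescopes in steps of two, since (p^3 - p) p^n = p^(n+3) - p^(n+1) and the gcd depends
  only on parity. With m = k + 1, the product counts the elements of the field with p^m elements
  that lie outside the one with p^2.\<close>

lemma mult_fib_deg:
  assumes "p \<ge> 2"
  shows "(p ^ 3 - p) * fib_deg p (k + 1) + p ^ gcd (k + 1) 2 = p ^ (k + 1)"
proof (induction k rule: less_induct)
  case (less k)
  consider "k = 0" | "k = 1" | n where "k = n + 2"
    by (metis One_nat_def add_2_eq_Suc' nat.exhaust)
  thus ?case
  proof cases
    case 3
    have deg: "fib_deg p (k + 1) = p ^ n + fib_deg p (n + 1)"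
      using fib_deg_add2[of p n] assms 3 by (simp add: eval_nat_numeral)
    have "gcd (n + 3) 2 = gcd (n + 1) 2"
      using gcd_add1[of "n + 1" 2] by (simp add: eval_nat_numeral)
    hence g: "gcd (k + 1) 2 = gcd (n + 1) 2"
      using 3 by (simp add: eval_nat_numeral)
    have IH: "(p ^ 3 - p) * fib_deg p (n + 1) + p ^ gcd (n + 1) 2 = p ^ (n + 1)"
      by (rule less) (simp add: 3)
    have "p \<le> p ^ 3"
      using assms by (simp add: self_le_power)
    hence "(p ^ 3 - p) * p ^ n + p ^ (n + 1) = p ^ (n + 3)"
      by (simp add: diff_mult_distrib power_add)
    thus ?thesis
      using IH unfolding deg g by (simp add: 3 distrib_left add.assoc eval_nat_numeral)
  qed (auto simp: numeral_2_eq_2)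
qed

lemma fib_poly_monic:
  assumes "p \<ge> 2"
  shows "degree (fib_poly p (Suc m) :: 'a :: idom poly) = fib_deg p (Suc m) \<and>
    coeff (fib_poly p (Suc m) :: 'a poly) (fib_deg p (Suc m)) = 1"
proof (induction m rule: less_induct)
  case (less m)
  consider "m = 0" | "m = 1" | n where "m = n + 2"
    by (metis One_nat_def add_2_eq_Suc' nat.exhaust)
  thus ?case
  proof cases
    case 3
    let ?e = "fib_shift p (n + 3)"
    have IH: "degree (fib_poly p (n + 2) :: 'a poly) = fib_deg p (n + 2)"
        "coeff (fib_poly p (n + 2) :: 'a poly) (fib_deg p (n + 2)) = 1"
        "degree (fib_poly p (n + 1) :: 'a poly) = fib_deg p (n + 1)"
      using less[of "n + 1"] less[of n] 3 by simp_all
    have deg: "fib_deg p (n + 3) = ?e + fib_deg p (n + 2)"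
      by (simp add: eval_nat_numeral)
    have rec: "fib_poly p (n + 3) =
        monom 1 ?e * fib_poly p (n + 2) + (fib_poly p (n + 1) :: 'a poly)"
      by (simp add: eval_nat_numeral)
    have lt: "fib_deg p (n + 1) < ?e + fib_deg p (n + 2)"
      using fib_deg_less_fib_shift[OF assms, of n] by simp
    have "fib_poly p (n + 2) \<noteq> (0 :: 'a poly)"
      using IH(2) by (metis coeff_0 zero_neq_one)
    hence d: "degree (monom 1 ?e * fib_poly p (n + 2) :: 'a poly) = ?e + fib_deg p (n + 2)"
      using IH(1) by (subst degree_mult_eq) (simp_all add: degree_monom_eq del: fib_poly.simps)
    have "degree (fib_poly p (n + 3) :: 'a poly) = fib_deg p (n + 3)"
      unfolding rec deg by (subst degree_add_eq_left) (use d lt IH in auto)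
    moreover have "coeff (fib_poly p (n + 3) :: 'a poly) (fib_deg p (n + 3)) = 1"
      unfolding rec deg using lt IH by (simp add: coeff_monom_mult coeff_eq_0)
    moreover have "Suc m = n + 3" using 3 by simp
    ultimately show ?thesis by (simp only:)
  qed (auto simp: numeral_2_eq_2)
qed

lemmas degree_fib_poly = fib_poly_monic[THEN conjunct1]

section \<open>Coefficients, supports and digits in base -p\<close>

lemma coeff_fib_poly_rec:
  assumes "p \<ge> 2" "m \<ge> 1"
  shows "coeff (fib_poly p (m + 2) :: 'a :: idom poly) i =
    (if i < fib_shift p (m + 2) then coeff (fib_poly p m) i
     else coeff (fib_poly p (m + 1)) (i - fib_shift p (m + 2)))"
proof -
  obtain k where k: "m = Suc k" using assms(2) by (cases m) auto
  have "coeff (fib_poly p m :: 'a poly) i = 0" if "i \<ge> fib_shift p (m + 2)"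
  proof (rule coeff_eq_0)
    have "fib_deg p (k + 1) < fib_shift p (k + 3)"
      using fib_deg_less_fib_shift[OF assms(1)] .
    moreover have "k + 3 = m + 2" using k by simp
    ultimately have "fib_deg p m < i" using that k by simp
    thus "degree (fib_poly p m :: 'a poly) < i"
      unfolding k using degree_fib_poly[OF assms(1), of k, where 'a = 'a] by simp
  qed
  thus ?thesis
    by (simp add: coeff_monom_mult)
qed

lemma coeff_fib_poly_in: "p \<ge> 2 \<Longrightarrow> coeff (fib_poly p m :: 'a :: idom poly) i \<in> {0, 1}"
proof (induction m arbitrary: i rule: less_induct)
  case (less m)
  consider "m = 0" | "m = 1" | "m = 2" | n where "m = n + 2" "n \<ge> 1"
    by (metis One_nat_def Suc_1 Suc_eq_plus1 add_2_eq_Suc' le_add2 nat.exhaust)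
  thus ?case
  proof cases
    case 4
    show ?thesis
      using less.IH[of n] less.IH[of "n + 1"] less.prems 4
      unfolding 4 coeff_fib_poly_rec[OF less.prems 4(2)] by simp
  qed (auto simp: numeral_2_eq_2)
qed

text \<open>All exponents of \<open>fib_poly p m\<close> lie below the shift, so they miss the
  shifted copy. Disjointness gives the Fibonacci count, and the unshifted copy gives the inclusion
  of S(m) in S(m+2).\<close>

lemma support_fib_poly_rec:
  assumes "p \<ge> 2" "m \<ge> 1"
  shows "{i. coeff (fib_poly p (m + 2) :: 'a :: idom poly) i \<noteq> 0} =
      (+) (fib_shift p (m + 2)) ` {i. coeff (fib_poly p (m + 1) :: 'a poly) i \<noteq> 0} \<union>
      {i. coeff (fib_poly p m :: 'a poly) i \<noteq> 0}" (is "?A = ?s ` ?B \<union> ?C")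
    and "(+) (fib_shift p (m + 2)) ` {i. coeff (fib_poly p (m + 1) :: 'a poly) i \<noteq> 0} \<inter>
      {i. coeff (fib_poly p m :: 'a poly) i \<noteq> 0} = {}"
proof -
  have C: "?C \<subseteq> {..<fib_shift p (m + 2)}"
  proof
    fix i assume i: "i \<in> ?C"
    obtain k where k: "m = Suc k" using assms(2) by (cases m) auto
    have "fib_deg p (k + 1) < fib_shift p (k + 3)"
      using fib_deg_less_fib_shift[OF assms(1)] .
    moreover have "k + 3 = m + 2" using k by simp
    moreover have "i \<le> degree (fib_poly p m :: 'a poly)"
      using i by (simp add: le_degree)
    ultimately show "i \<in> {..<fib_shift p (m + 2)}"
      unfolding k using degree_fib_poly[OF assms(1), of k, where 'a = 'a] by simp
  qed
  show "?s ` ?B \<inter> ?C = {}"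
    using C by auto
  show "?A = ?s ` ?B \<union> ?C"
  proof (intro set_eqI)
    fix i
    show "i \<in> ?A \<longleftrightarrow> i \<in> ?s ` ?B \<union> ?C"
    proof (cases "i < fib_shift p (m + 2)")
      case True
      thus ?thesis
        unfolding mem_Collect_eq coeff_fib_poly_rec[OF assms] by auto
    next
      case False
      hence "i \<notin> ?C" using C by auto
      moreover have "i \<in> ?s ` ?B \<longleftrightarrow> i - fib_shift p (m + 2) \<in> ?B"
        using False by (auto simp: image_iff intro: exI[of _ "i - fib_shift p (m + 2)"])
      ultimately show ?thesis
        using False unfolding mem_Collect_eq coeff_fib_poly_rec[OF assms] by auto
    qed
  qed
qed

lemma card_support_fib_poly:
  "p \<ge> 2 \<Longrightarrow> card {i. coeff (fib_poly p m :: 'a :: idom poly) i \<noteq> 0} = fib m"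
proof (induction m rule: less_induct)
  case (less m)
  consider "m = 0" | "m = 1" | "m = 2" | n where "m = n + 2" "n \<ge> 1"
    by (metis One_nat_def Suc_1 Suc_eq_plus1 add_2_eq_Suc' le_add2 nat.exhaust)
  thus ?case
  proof cases
    case 4
    have fin: "finite {i. coeff (q :: 'a poly) i \<noteq> 0}" for q
      using MOST_coeff_eq_0[of q] by (simp add: eventually_cofinite)
    show ?thesis
      unfolding 4(1) support_fib_poly_rec(1)[OF less.prems 4(2)]
      by (subst card_Un_disjoint)
         (use fin support_fib_poly_rec(2)[OF less.prems 4(2), where 'a = 'a]
              less.IH[of n] less.IH[of "n + 1"] less.prems 4 in
            \<open>simp_all add: card_image del: fib_poly.simps\<close>)
  qed (simp_all add: coeff_monom coeff_1 numeral_2_eq_2)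
qed

text \<open>The sign treats odd and even \<open>m\<close> in one induction. The bound on
  \<open>A\<close> is carried along so that the next shift can complement \<open>A\<close>.\<close>

lemma support_fib_poly_digits:
  assumes "p \<ge> 2" "m \<ge> 1" "coeff (fib_poly p m :: 'a :: idom poly) i \<noteq> 0"
  shows "\<exists>A \<subseteq> {..<m - 2}. (- 1) ^ Suc m * int i = (\<Sum>j\<in>A. (- int p) ^ j)"
  using assms(2,3)
proof (induction m arbitrary: i rule: less_induct)
  case (less m)
  consider "m = 1" | "m = 2" | n where "m = n + 2" "n \<ge> 1"
    using less.prems(1)
    by (metis One_nat_def Suc_1 Suc_eq_plus1 add_2_eq_Suc' le_add2 nat.exhaust not_one_le_zero)
  thus ?case
  proof cases
    case 3
    consider (shift) k where "i = fib_shift p (n + 2) + k"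
        "coeff (fib_poly p (n + 1) :: 'a poly) k \<noteq> 0"
      | (old) "coeff (fib_poly p n :: 'a poly) i \<noteq> 0"
      using less.prems(2) support_fib_poly_rec(1)[OF assms(1) 3(2), where 'a = 'a] 3(1)
      by blast
    thus ?thesis
    proof cases
      case shift
      obtain A where A: "A \<subseteq> {..<n - 1}"
          "(- 1) ^ Suc (n + 1) * int k = (\<Sum>j\<in>A. (- int p) ^ j)"
        using less.IH[of "n + 1" k] shift 3 by auto
      have "int (fib_shift p (n + 2)) = theta (int (n - 1)) p"
        using theta_nonneg[of p] assms(1) 3(2) by (simp add: fib_shift_def of_nat_diff)
      also have "\<dots> = (- 1) ^ (n - 1) * (\<Sum>j<n. (- int p) ^ j)"
        using 3(2) by (simp only: theta_eq_negabase_sum) simp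
      \<comment> \<open>\<open>n - 1\<close> and \<open>Suc m = n + 3\<close> have the same
        parity.\<close>
      also have "(- 1) ^ (n - 1) = (- 1 :: int) ^ Suc m"
        using 3 by (auto simp: uminus_power_if)
      finally have "(- 1) ^ Suc m * int (fib_shift p (n + 2)) = (\<Sum>j<n. (- int p) ^ j)"
        by (simp add: uminus_power_if)
      moreover have "(- 1) ^ Suc m * int k = - (\<Sum>j\<in>A. (- int p) ^ j)"
        using A(2) 3(1) by simp
      ultimately have "(- 1) ^ Suc m * int i = (\<Sum>j<n. (- int p) ^ j) - (\<Sum>j\<in>A. (- int p) ^ j)"
        unfolding shift(1) by (simp only: of_nat_add distrib_left)
      \<comment> \<open>Subtracting from the number with \<open>n\<close> digits 1 flips every
        digit; no borrowing occurs because \<open>A\<close> lies below \<open>n\<close>.\<close>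
      also have "\<dots> = (\<Sum>j\<in>{..<n} - A. (- int p) ^ j)"
        using A(1) by (intro sum_diff[symmetric]) auto
      finally show ?thesis
        using 3(1) by (intro exI[of _ "{..<n} - A"]) auto
    next
      case old
      then obtain A where "A \<subseteq> {..<n - 2}" "(- 1) ^ Suc n * int i = (\<Sum>j\<in>A. (- int p) ^ j)"
        using less.IH[of n i] 3 by auto
      thus ?thesis
        using 3(1) by (intro exI[of _ A]) auto
    qed
  qed (use less.prems in \<open>auto simp: coeff_1 coeff_monom numeral_2_eq_2 split: if_splits\<close>)
qed

lemma negabase_digits_sum_powers:
  assumes "p \<ge> 2" "finite A" "n = (\<Sum>j\<in>A. (- int p) ^ j)"
  shows "negabase_digits p n j \<in> {0, 1}"
proof -
  define d where "d = (\<lambda>j. if j \<in> A then 1 else 0 :: nat)"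
  have "{j. d j \<noteq> 0} = A" by (auto simp: d_def)
  hence "is_negabase_expansion p n d"
    using assms by (auto simp: is_negabase_expansion_def d_def intro!: sum.cong)
  hence "negabase_digits p n = d"
    using negabase_expansion_unique is_negabase_expansion_negabase_digits[OF assms(1)] by blast
  thus ?thesis by (simp add: d_def)
qed

section \<open>Brackets and their evaluation through \<nu>\<close>

lemma frobenius_diff:
  fixes x y :: "'a :: field"
  assumes "prime p" "CHAR('a) = p"
  shows "(x - y) ^ (p ^ n) = x ^ (p ^ n) - y ^ (p ^ n)"
  using freshmans_dream'[of "p ^ n" n "x - y" y] assms by (simp add: eq_diff_eq)

lemma bracket_shift:
  fixes x y :: "'a :: field"
  assumes "prime p" "CHAR('a) = p"
  shows "bracket p x y (i + k) (j + k) = bracket p x y i j ^ (p ^ k)"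
  by (simp add: bracket_def frobenius_diff[OF assms] power_mult_distrib power_add power_mult)

text \<open>Brackets are the 2 x 2 minors of the matrix with columns (x^(p^i), y^(p^i)).\<close>

lemma bracket_plucker:
  "bracket p x y a b * bracket p x y c d - bracket p x y a c * bracket p x y b d
     + bracket p x y a d * bracket p x y b c = 0"
  by (simp add: bracket_def algebra_simps)

lemma nu_eq:
  fixes x y :: "'a :: field"
  assumes "prime p" "CHAR('a) = p"
  shows "nu p x y = - (bracket p x y 0 2 ^ (p + 1) / bracket p x y 0 1 ^ (p ^ 2 + 1))"
  using bracket_shift[OF assms, of x y 0 1 2] bracket_shift[OF assms, of x y 0 2 1]
  by (simp add: nu_def power_add numeral_3_eq_3 numeral_2_eq_2)

text \<open>Only the nonvanishing of the scalar matters later, as it makes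
  \<open>bracket p x y 0 m\<close> and the polynomial value vanish together.\<close>

lemma bracket_eq_fib_poly:
  fixes x y :: "'a :: field"
  assumes p: "prime p" "CHAR('a) = p"
    and D: "bracket p x y 0 1 \<noteq> 0" and E: "bracket p x y 0 2 \<noteq> 0"
  shows "\<exists>c. c \<noteq> 0 \<and> bracket p x y 0 m = c * poly (fib_poly p m) (nu p x y)"
proof -
  define D where "D = bracket p x y 0 1"
  define E where "E = bracket p x y 0 2"
  define z where "z = nu p x y"
  define B where "B = bracket p x y 0"
  have nz: "D \<noteq> 0" "E \<noteq> 0" using assms by (simp_all add: D_def E_def)
  \<comment> \<open>The formula for \<nu> with denominators cleared, raised to the power p^m. The
    minus sign survives for p = 2 too, by additivity of Frobenius.\<close>
  have z: "z ^ (p ^ m) * D ^ (p ^ m * p ^ 2) * D ^ p ^ m = - (E ^ (p ^ m) * E ^ (p ^ m * p))" for m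
  proof -
    have "z * D ^ (p ^ 2 + 1) = - (E ^ (p + 1))"
      using nz(1) unfolding z_def nu_eq[OF p] by (simp add: D_def E_def)
    hence "(z * D ^ (p ^ 2 + 1)) ^ (p ^ m) = (- (E ^ (p + 1))) ^ (p ^ m)"
      by simp
    also have "\<dots> = - ((E ^ (p + 1)) ^ (p ^ m))"
      using frobenius_diff[OF p, of 0 "E ^ (p + 1)" m] prime_gt_0_nat[OF p(1)]
      by (simp add: power_0_left)
    finally show ?thesis
      by (simp add: power_mult_distrib power_mult[symmetric] power_add distrib_left ac_simps)
  qed
  have rec: "B (m + 2) * D ^ (p ^ m) = B (m + 1) * E ^ (p ^ m) - B m * D ^ (p ^ m * p)" for m
    using bracket_plucker[of p x y 0 m "m + 1" "m + 2"]
      bracket_shift[OF p, of x y 0 m 1] bracket_shift[OF p, of x y 0 m 2]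
      bracket_shift[OF p, of x y 0 "m + 1" 1]
    by (simp add: B_def D_def E_def algebra_simps)
  \<comment> \<open>The last conjunct strengthens the induction: it turns the coefficient E^(p^m) of
    \<open>rec\<close> into the power of \<open>z\<close> that the polynomial recurrence asks
    for.\<close>
  have "\<exists>c d. c \<noteq> 0 \<and> d \<noteq> 0 \<and> B (m + 1) = c * poly (fib_poly p (m + 1)) z \<and>
      B m = d * poly (fib_poly p m) z \<and>
      c * E ^ (p ^ m) = - d * z ^ fib_shift p (m + 2) * D ^ (p ^ m * p)" for m
  proof (induction m)
    case 0
    show ?case
      \<comment> \<open>\<open>B 0 = 0\<close> leaves the second scalar free; the last conjunct
        forces its value.\<close>
      by (rule exI[of _ D], rule exI[of _ "- (E / D ^ p * D)"])
         (use nz in \<open>simp add: B_def D_def bracket_def\<close>)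
  next
    case (Suc m)
    then obtain c d where cd: "c \<noteq> 0" "d \<noteq> 0" "B (m + 1) = c * poly (fib_poly p (m + 1)) z"
        "B m = d * poly (fib_poly p m) z"
        "c * E ^ (p ^ m) = - d * z ^ fib_shift p (m + 2) * D ^ (p ^ m * p)"
      by blast
    \<comment> \<open>The common factor of both terms of \<open>rec\<close>, divided by the
      coefficient of \<open>B (m + 2)\<close>.\<close>
    define c' where "c' = - (d * D ^ (p ^ m * p) / D ^ (p ^ m))"
    have c': "c' \<noteq> 0" "c' * D ^ (p ^ m) = - (d * D ^ (p ^ m * p))"
      using nz cd by (simp_all add: c'_def)
    have "B (m + 2) * D ^ (p ^ m) = (c * E ^ (p ^ m)) * poly (fib_poly p (m + 1)) z
        - d * poly (fib_poly p m) z * D ^ (p ^ m * p)"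
      unfolding rec cd(3,4) by (simp add: algebra_simps)
    also have "\<dots> = - (d * D ^ (p ^ m * p)) *
        (z ^ fib_shift p (m + 2) * poly (fib_poly p (m + 1)) z + poly (fib_poly p m) z)"
      unfolding cd(5) by (simp add: algebra_simps)
    also have "\<dots> = c' * poly (fib_poly p (m + 2)) z * D ^ (p ^ m)"
      by (simp add: c'(2)[symmetric] poly_monom)
    finally have B: "B (m + 2) = c' * poly (fib_poly p (m + 2)) z"
      using nz by simp
    have E: "c' * E ^ (p ^ m * p) =
        - c * z ^ fib_shift p (m + 3) * D ^ (p ^ m * p ^ 2)" (is "?l = ?r")
    proof -
      \<comment> \<open>Consecutive shifts add up to p^m, so the old and new powers of
        \<open>z\<close> combine into the one that relation \<open>z\<close> evaluates.\<close>
      have zz: "z ^ fib_shift p (m + 3) * z ^ fib_shift p (m + 2) = z ^ (p ^ m)"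
        using fib_shift_add[of p m] prime_ge_1_nat[OF p(1)] by (simp flip: power_add)
      have "?r * (E ^ (p ^ m) * D ^ (p ^ m)) =
          - (c * E ^ (p ^ m)) * z ^ fib_shift p (m + 3) * D ^ (p ^ m * p ^ 2) * D ^ (p ^ m)"
        by (simp only: ac_simps mult_minus_left mult_minus_right)
      also have "\<dots> = d * D ^ (p ^ m * p) *
          ((z ^ fib_shift p (m + 3) * z ^ fib_shift p (m + 2)) * D ^ (p ^ m * p ^ 2) * D ^ (p ^ m))"
        unfolding cd(5) by (simp only: ac_simps mult_minus_left mult_minus_right minus_minus)
      also have "\<dots> = - (d * D ^ (p ^ m * p)) * (E ^ (p ^ m) * E ^ (p ^ m * p))"
        unfolding zz z by (simp only: mult_minus_left mult_minus_right)
      also have "\<dots> = ?l * (E ^ (p ^ m) * D ^ (p ^ m))"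
        unfolding c'(2)[symmetric] by (simp only: ac_simps)
      finally show ?thesis
        using nz by (metis mult_eq_0_iff mult_right_cancel power_not_zero)
    qed
    show ?case
      by (rule exI[of _ c'], rule exI[of _ c])
         (use B E c'(1) cd(1,3) in \<open>simp add: power2_eq_square ac_simps numeral_3_eq_3\<close>)
  qed
  thus ?thesis
    unfolding B_def z_def by blast
qed

section \<open>Linear independence, finite subfields and the set of values of \<nu>\<close>

text \<open>\<open>bracket p x y 0 1\<close> is the Moore determinant of x and y. If it vanishes,
  Frobenius fixes x / y, which therefore lies in the prime field.\<close>

lemma lin_indep_Fp_iff:
  fixes x y :: "'a :: alg_closed_field"
  assumes p: "prime p" "CHAR('a) = p"
  shows "lin_indep_Fp x y \<longleftrightarrow> bracket p x y 0 1 \<noteq> 0"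
proof -
  have P: "a ^ p = a" if "a \<in> prime_subfield" for a :: 'a
    using that by (simp add: prime_subfield_eq_finite_subfield[OF p] finite_subfield_def)
  have P': "a \<in> prime_subfield" if "a ^ p = a" for a :: 'a
    using that by (simp add: prime_subfield_eq_finite_subfield[OF p] finite_subfield_def)
  have "1 \<in> (prime_subfield :: 'a set)" "0 \<in> (prime_subfield :: 'a set)"
    using p(1) by (auto intro!: P' simp: prime_gt_0_nat)
  show ?thesis
  proof
    assume L: "lin_indep_Fp x y"
    have y: "y \<noteq> 0"
      using L \<open>1 \<in> prime_subfield\<close> \<open>0 \<in> prime_subfield\<close>
      unfolding lin_indep_Fp_def by (metis add.right_neutral mult_zero_left mult_zero_right zero_neq_one)
    show "bracket p x y 0 1 \<noteq> 0"
    proof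
      assume "bracket p x y 0 1 = 0"
      hence "(x / y) ^ p = x / y"
        using y by (simp add: bracket_def field_simps)
      hence "(- (x / y)) ^ p = - (x / y)"
        using frobenius_diff[OF p, of 0 "x / y" 1] prime_gt_0_nat[OF p(1)]
        by (simp add: zero_power)
      hence "- (x / y) \<in> prime_subfield" by (rule P')
      moreover have "1 * x + - (x / y) * y = 0" using y by simp
      ultimately show False
        using L \<open>1 \<in> prime_subfield\<close> unfolding lin_indep_Fp_def by (metis zero_neq_one)
    qed
  next
    assume D: "bracket p x y 0 1 \<noteq> 0"
    show "lin_indep_Fp x y"
      unfolding lin_indep_Fp_def
    proof (intro ballI impI)
      fix a b :: 'a
      assume ab: "a \<in> prime_subfield" "b \<in> prime_subfield" "a * x + b * y = 0"
      have "a * x = - (b * y)" using ab(3) by (simp add: eq_neg_iff_add_eq_0)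
      have "a * x ^ p + b * y ^ p = (a * x + b * y) ^ p"
        using P[OF ab(1)] P[OF ab(2)]
        by (subst freshmans_dream) (use p in \<open>simp_all add: power_mult_distrib\<close>)
      hence *: "a * x ^ p + b * y ^ p = 0"
        using ab(3) p(1) by (simp add: prime_gt_0_nat)
      \<comment> \<open>Cramer's rule for the linear relation together with its Frobenius
        image.\<close>
      have "a * bracket p x y 0 1 = y ^ p * (a * x + b * y) - y * (a * x ^ p + b * y ^ p)"
        by (simp add: bracket_def algebra_simps)
      moreover have "b * bracket p x y 0 1 = x * (a * x ^ p + b * y ^ p) - x ^ p * (a * x + b * y)"
        by (simp add: bracket_def algebra_simps)
      ultimately show "a = 0 \<and> b = 0"
        using D ab(3) * by simp
    qed
  qed
qed

lemma bracket_0_eq_0_iff: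
  fixes x y :: "'a :: field"
  assumes "y \<noteq> 0" "p \<ge> 1"
  shows "bracket p x y 0 m = 0 \<longleftrightarrow> x / y \<in> finite_subfield p m"
  using assms by (auto simp: bracket_def finite_subfield_def field_simps)

text \<open>Euclid's algorithm by subtraction on the exponents.\<close>

lemma finite_subfield_gcd:
  assumes p: "prime p" "CHAR('a :: field) = p"
  shows "finite_subfield p m \<inter> finite_subfield p n = (finite_subfield p (gcd m n) :: 'a set)"
proof (induction "m + n" arbitrary: m n rule: less_induct)
  case less
  have step: "finite_subfield p m \<inter> finite_subfield p n = (finite_subfield p (gcd m n) :: 'a set)"
    if le: "n \<le> m" and n: "n > 0"
      and IH: "finite_subfield p (m - n) \<inter> finite_subfield p n =
        (finite_subfield p (gcd (m - n) n) :: 'a set)" for m n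
  proof -
    have "x \<in> finite_subfield p m \<longleftrightarrow> x \<in> finite_subfield p (m - n)"
      if x: "x \<in> finite_subfield p n" for x :: 'a
    proof -
      \<comment> \<open>Uses x = x^(p^n); a power of a field element vanishes only if the element
        does.\<close>
      have "x ^ (p ^ m) - x = (x ^ (p ^ (m - n)) - x) ^ (p ^ n)"
        using le x unfolding frobenius_diff[OF p]
        by (simp add: finite_subfield_def flip: power_mult power_add)
      thus ?thesis
        using prime_gt_0_nat[OF p(1)] by (auto simp: finite_subfield_def zero_power)
    qed
    thus ?thesis
      using IH le by (auto simp: gcd_diff1_nat)
  qed
  consider "m = 0 \<or> n = 0" | "n > 0" "n \<le> m" | "m > 0" "m \<le> n" by linarith
  thus ?case
  proof cases
    case 1
    \<comment> \<open>\<open>finite_subfield p 0\<close> is the whole field, in accordance with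
      gcd(m, 0) = m.\<close>
    thus ?thesis by (auto simp: finite_subfield_def)
  next
    case 2
    show ?thesis
      by (rule step[OF 2(2,1)], rule less) (use 2 in auto)
  next
    case 3
    have "finite_subfield p n \<inter> finite_subfield p m = (finite_subfield p (gcd n m) :: 'a set)"
      by (rule step[OF 3(2,1)], rule less) (use 3 in auto)
    thus ?thesis by (simp add: Int_commute gcd.commute)
  qed
qed

lemma poly_fib_poly_nu_eq_0_iff:
  fixes x y :: "'a :: alg_closed_field"
  assumes p: "prime p" "CHAR('a) = p" and xy: "lin_indep_Fp x y" and nz: "nu p x y \<noteq> 0"
  shows "poly (fib_poly p m) (nu p x y) = 0 \<longleftrightarrow> x / y \<in> finite_subfield p m"
proof -
  have D: "bracket p x y 0 1 \<noteq> 0"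
    using xy lin_indep_Fp_iff[OF p] by blast
  have E: "bracket p x y 0 2 \<noteq> 0"
    using nz by (auto simp: nu_def)
  have "y \<noteq> 0"
    using D p(1) by (auto simp: bracket_def prime_gt_0_nat)
  thus ?thesis
    using bracket_eq_fib_poly[OF p D E, of m] bracket_0_eq_0_iff[of y p x m] prime_ge_1_nat[OF p(1)]
    by auto
qed

lemma quotient_mem_finite_subfield:
  assumes p: "prime p" "CHAR('a :: field) = p"
    and "x \<in> finite_subfield p m" "y \<in> (finite_subfield p m :: 'a set)"
  shows "x / y \<in> finite_subfield p m"
  using assms by (simp add: finite_subfield_def power_divide)

lemma Zset0_E:
  fixes z :: "'a :: alg_closed_field"
  assumes p: "prime p" "CHAR('a) = p" and z: "z \<in> Zset0 m p"
  obtains x y where "z = nu p x y" "lin_indep_Fp x y" "x / y \<in> finite_subfield p m"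
  using z quotient_mem_finite_subfield[OF p] unfolding Zset0_def Zset_def by blast

text \<open>Numerator and denominator of \<nu> are both homogeneous of degree 1 + p + p^2 + p^3, so
  \<nu> depends only on x / y.\<close>

lemma nu_scale:
  fixes x y :: "'a :: field"
  assumes "c \<noteq> 0"
  shows "nu p (c * x) (c * y) = nu p x y"
proof -
  have *: "bracket p (c * x) (c * y) i j = c ^ (p ^ i) * c ^ (p ^ j) * bracket p x y i j" for i j
    by (simp add: bracket_def power_mult_distrib algebra_simps)
  show ?thesis
    unfolding nu_def * using assms by (simp add: field_simps)
qed

text \<open>Several pairs may share a value of \<nu>, but being a root of
  \<open>fib_poly p m\<close> depends on the value alone. Hence the ratios of all such pairs lie in
  the subfield, or none does.\<close>

lemma nu_mem_Zset0_iff: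
  fixes x y :: "'a :: alg_closed_field"
  assumes p: "prime p" "CHAR('a) = p" and xy: "lin_indep_Fp x y" and nz: "nu p x y \<noteq> 0"
  shows "nu p x y \<in> Zset0 m p \<longleftrightarrow> x / y \<in> finite_subfield p m"
proof
  assume "nu p x y \<in> Zset0 m p"
  then obtain u v where uv: "nu p x y = nu p u v" "lin_indep_Fp u v" "u / v \<in> finite_subfield p m"
    by (rule Zset0_E[OF p])
  hence "poly (fib_poly p m) (nu p x y) = 0"
    using poly_fib_poly_nu_eq_0_iff[OF p uv(2)] nz by simp
  thus "x / y \<in> finite_subfield p m"
    using poly_fib_poly_nu_eq_0_iff[OF p xy nz] by simp
next
  assume t: "x / y \<in> finite_subfield p m"
  have D: "bracket p x y 0 1 \<noteq> 0"
    using xy lin_indep_Fp_iff[OF p] by blast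
  have y: "y \<noteq> 0"
    using D p(1) by (auto simp: bracket_def prime_gt_0_nat)
  have "bracket p (x / y) 1 0 1 \<noteq> 0"
    using D y by (auto simp: bracket_def field_simps)
  hence "lin_indep_Fp (x / y) 1"
    using lin_indep_Fp_iff[OF p] by blast
  moreover have "nu p x y = nu p (x / y) 1"
    using nu_scale[of y p "x / y" 1] y by simp
  moreover have "1 \<in> (finite_subfield p m :: 'a set)"
    by (simp add: finite_subfield_def)
  ultimately show "nu p x y \<in> Zset0 m p"
    using t nz unfolding Zset0_def Zset_def by blast
qed

lemma poly_fib_poly_Zset0:
  fixes z :: "'a :: alg_closed_field"
  assumes p: "prime p" "CHAR('a) = p" and z: "z \<in> Zset0 m p"
  shows "poly (fib_poly p m) z = 0"
proof -
  obtain x y where xy: "z = nu p x y" "lin_indep_Fp x y" "x / y \<in> finite_subfield p m"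
    using Zset0_E[OF p z] .
  moreover have "z \<noteq> 0" using z by (simp add: Zset0_def)
  ultimately show ?thesis
    using poly_fib_poly_nu_eq_0_iff[OF p xy(2)] by simp
qed

text \<open>One pair representing z decides membership in all three sets through its ratio, so the
  claim reduces to intersecting subfields.\<close>

lemma Zset0_gcd:
  assumes p: "prime p" "CHAR('a :: alg_closed_field) = p"
  shows "Zset0 m p \<inter> Zset0 n p = (Zset0 (gcd m n) p :: 'a set)"
proof -
  have "z \<in> Zset0 m p \<and> z \<in> Zset0 n p \<longleftrightarrow> z \<in> Zset0 (gcd m n) p"
    if z: "z \<in> Zset0 m p \<union> Zset0 n p \<union> Zset0 (gcd m n) p" for z :: 'a
  proof -
    obtain x y where "z = nu p x y" "lin_indep_Fp x y" "z \<noteq> 0"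
      using z unfolding Zset0_def Zset_def by auto
    thus ?thesis
      using nu_mem_Zset0_iff[OF p, of x y] finite_subfield_gcd[OF p, of m n] by auto
  qed
  thus ?thesis by auto
qed

section \<open>Counting the values of \<nu>\<close>

text \<open>With \<open>s = t ^ p - t\<close> one has \<open>[0,1] = - s\<close> and \<open>[0,2] = - s * (s ^ (p - 1) + 1)\<close> for
  \<open>(x, y) = (t, 1)\<close>, hence \<open>\<nu>(t, 1) = - (s ^ (p - 1) + 1) ^ (p + 1) / s ^ (p ^ 2 - p)\<close>, where the
  numerator has degree \<open>p ^ 3 - p\<close> in \<open>t\<close> and the denominator has smaller degree.\<close>
lemma card_nu_fibre:
  fixes z :: "'a :: alg_closed_field"
  assumes p: "prime p" "CHAR('a) = p"
  defines "S \<equiv> {t. bracket p t 1 0 1 \<noteq> 0 \<and> nu p t 1 = z}"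
  shows "finite S" "card S \<le> p ^ 3 - p"
proof -
  have p2: "p \<ge> 2" using p(1) by (rule prime_ge_2_nat)
  define s :: "'a poly" where "s = monom 1 p - [:0, 1:]"
  define g where "g = s ^ (p - 1) + 1"
  \<comment> \<open>The equation \<nu>(t, 1) = z with the denominator cleared; its degree is the
    same for every z.\<close>
  define Q where "Q = g ^ (p + 1) + smult z (s ^ (p ^ 2 - p))"
  have s_def': "s = monom 1 p + (- [:0, 1:])" by (simp add: s_def)
  have deg_s: "degree s = p"
    unfolding s_def' using p2 by (subst degree_add_eq_left) (auto simp: degree_monom_eq)
  have s0: "s \<noteq> 0" using deg_s p2 by auto
  have deg_sp: "degree (s ^ k) = p * k" for k
    using s0 by (simp add: degree_power_eq deg_s)
  have deg_g: "degree g = p * (p - 1)"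
    unfolding g_def using p2 by (subst degree_add_eq_left) (auto simp: deg_sp)
  have g0: "g \<noteq> 0" using deg_g p2 by auto
  have e1: "p * (p - 1) * (p + 1) = p ^ 3 - p"
    by (simp add: algebra_simps power3_eq_cube)
  have e2: "p * (p ^ 2 - p) = p ^ 3 - p ^ 2"
    by (simp add: algebra_simps power3_eq_cube power2_eq_square)
  have deg_gp: "degree (g ^ (p + 1)) = p ^ 3 - p"
    unfolding degree_power_eq[OF g0] deg_g e1[symmetric] by (simp only: ac_simps)
  have "p ^ 2 \<le> p ^ 3" using p2 by (intro power_increasing) auto
  moreover have "p < p ^ 2" using p2 by (simp add: power2_eq_square)
  ultimately have "p ^ 3 - p ^ 2 < p ^ 3 - p" by linarith
  hence "degree (smult z (s ^ (p ^ 2 - p))) < p ^ 3 - p"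
    using deg_sp[of "p ^ 2 - p"] e2 by (cases "z = 0") auto
  hence degQ: "degree Q = p ^ 3 - p"
    unfolding Q_def by (subst degree_add_eq_left) (simp_all only: deg_gp)
  have "p ^ 3 - p > 0" using \<open>p ^ 3 - p ^ 2 < p ^ 3 - p\<close> by linarith
  hence Q0: "Q \<noteq> 0" using degQ by auto
  have sub: "S \<subseteq> {t. poly Q t = 0}"
  proof
    fix t assume t: "t \<in> S"
    define u where "u = t ^ p - t"
    have u: "poly s t = u" by (simp add: s_def u_def poly_monom)
    have D: "bracket p t 1 0 1 = - u" by (simp add: bracket_def u_def)
    have u0: "u \<noteq> 0" using t D by (auto simp: S_def)
    have "u ^ p = t ^ (p ^ 2) - t ^ p"
      using frobenius_diff[OF p, of "t ^ p" t 1] by (simp add: u_def power2_eq_square power_mult)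
    hence "bracket p t 1 0 2 = - (u ^ p + u)"
      by (simp add: bracket_def u_def)
    also have "\<dots> = - (u * (u ^ (p - 1) + 1))"
      using p2 by (simp add: algebra_simps flip: power_Suc)
    also have "\<dots> = - (u * poly g t)"
      by (simp add: g_def u)
    finally have E: "bracket p t 1 0 2 = - (u * poly g t)" .
    \<comment> \<open>This confines the sign of \<open>- u\<close> to the factor (-u)^(p+1), which
      cancels.\<close>
    have "even (p ^ 2 - p)"
      by (simp add: power2_eq_square)
    have "p ^ 2 + 1 = (p ^ 2 - p) + (p + 1)"
      using \<open>p < p ^ 2\<close> by simp
    hence "(- u) ^ (p ^ 2 + 1) = (- u) ^ (p ^ 2 - p) * (- u) ^ (p + 1)"
      by (simp only: power_add)
    also have "(- u) ^ (p ^ 2 - p) = u ^ (p ^ 2 - p)"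
      using \<open>even (p ^ 2 - p)\<close> by (rule power_minus_even)
    finally have "nu p t 1 = - (((- u) ^ (p + 1) * poly g t ^ (p + 1)) /
        (u ^ (p ^ 2 - p) * (- u) ^ (p + 1)))"
      unfolding nu_eq[OF p] D E by (simp only: mult_minus_left[symmetric] power_mult_distrib)
    also have "\<dots> = - (poly g t ^ (p + 1) / u ^ (p ^ 2 - p))"
      using u0 by simp
    finally have "nu p t 1 = - (poly g t ^ (p + 1) / u ^ (p ^ 2 - p))" .
    hence "z = - (poly g t ^ (p + 1) / u ^ (p ^ 2 - p))"
      using t unfolding S_def by blast
    hence "poly g t ^ (p + 1) + z * u ^ (p ^ 2 - p) = 0"
      using u0 by simp
    thus "t \<in> {t. poly Q t = 0}"
      by (simp add: Q_def u)
  qed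
  have fin: "finite {t. poly Q t = 0}" using Q0 by (rule poly_roots_finite)
  show "finite S" using sub fin by (rule finite_subset)
  have "card S \<le> card {t. poly Q t = 0}" using fin sub by (rule card_mono)
  also have "\<dots> \<le> degree Q" using Q0 by (rule card_poly_roots_bound)
  finally show "card S \<le> p ^ 3 - p" by (simp add: degQ)
qed

text \<open>Elements of the subfield outside the one with p^2 elements give nonzero values of \<nu>.
  Each fibre has at most p^3 - p elements, and \<open>mult_fib_deg\<close> makes the quotient
  exact.\<close>

lemma card_Zset0_ge:
  assumes p: "prime p" "CHAR('a :: alg_closed_field) = p" and m: "m \<ge> 1"
  shows "fib_deg p m \<le> card (Zset0 m p :: 'a set)"
proof -
  have p2: "p \<ge> 2" using p(1) by (rule prime_ge_2_nat)
  define K where "K n = (finite_subfield p n :: 'a set)" for n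
  define T where "T = K m - K 2"
  define fibre where "fibre z = {t :: 'a. bracket p t 1 0 1 \<noteq> 0 \<and> nu p t 1 = z}" for z
  have fin: "finite (Zset0 m p :: 'a set)"
    using finite_Zset[OF p m] by (simp add: Zset0_def)
  have cardK: "card (K n) = p ^ n" if "n \<ge> 1" for n
    unfolding K_def using card_finite_subfield[OF p that] .
  have finK: "finite (K m)"
    using cardK[OF m] p2 by (intro card_ge_0_finite) simp
  have "T \<subseteq> (\<Union>z\<in>Zset0 m p. fibre z)"
  proof
    fix t assume t: "t \<in> T"
    \<comment> \<open>\<open>K 1\<close> is contained in \<open>K 2\<close>, as gcd(1, 2) =
      1.\<close>
    have "t \<notin> K 1"
      using t finite_subfield_gcd[OF p, of 1 2] unfolding T_def K_def by auto
    hence D: "bracket p t 1 0 1 \<noteq> 0"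
      using bracket_0_eq_0_iff[of 1 p t 1] p2 by (simp add: K_def)
    have "bracket p t 1 0 2 \<noteq> 0"
      using t bracket_0_eq_0_iff[of 1 p t 2] p2 by (simp add: K_def T_def)
    hence "nu p t 1 \<noteq> 0"
      using D by (simp add: nu_eq[OF p])
    hence "nu p t 1 \<in> Zset0 m p"
      using nu_mem_Zset0_iff[OF p, of t 1 m] D t lin_indep_Fp_iff[OF p, of t 1]
      by (simp add: T_def K_def)
    thus "t \<in> (\<Union>z\<in>Zset0 m p. fibre z)"
      using D by (auto simp: fibre_def)
  qed
  hence "card T \<le> card (\<Union>z\<in>Zset0 m p. fibre z)"
    using fin card_nu_fibre(1)[OF p] by (intro card_mono) (auto simp: fibre_def)
  also have "\<dots> \<le> (\<Sum>z\<in>Zset0 m p. card (fibre z))"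
    using fin by (rule card_UN_le)
  also have "\<dots> \<le> (\<Sum>z\<in>(Zset0 m p :: 'a set). p ^ 3 - p)"
    using card_nu_fibre(2)[OF p] by (intro sum_mono) (simp add: fibre_def)
  finally have "card T \<le> (p ^ 3 - p) * card (Zset0 m p :: 'a set)"
    by (simp add: mult.commute)
  moreover have "card T = (p ^ 3 - p) * fib_deg p m"
  proof -
    have "K m \<inter> K 2 = K (gcd m 2)"
      unfolding K_def by (rule finite_subfield_gcd[OF p])
    moreover have "gcd m 2 \<ge> 1" using m by (simp add: Suc_leI)
    moreover have "card T = card (K m) - card (K m \<inter> K 2)"
      unfolding T_def using finK by (intro card_Diff_subset_Int) auto
    moreover have "(p ^ 3 - p) * fib_deg p m + p ^ gcd m 2 = p ^ m"
      using mult_fib_deg[OF p2, of "m - 1"] m by simp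
    ultimately show ?thesis
      using cardK m by simp
  qed
  moreover have "p ^ 3 - p > 0"
    using p2 power_strict_increasing[of 1 3 p] by simp
  ultimately show ?thesis by simp
qed

section \<open>Identification with \<open>fpoly\<close>, and the gcd\<close>

lemma fpoly_eq_fib_poly:
  assumes p: "prime p" "CHAR('a :: alg_closed_field) = p"
  shows "fpoly m p = (fib_poly p m :: 'a poly)"
proof (cases m)
  case (Suc k)
  have p2: "p \<ge> 2" using p(1) by (rule prime_ge_2_nat)
  define F where "F = (fib_poly p m :: 'a poly)"
  define P where "P = (\<Prod>z\<in>(Zset0 m p :: 'a set). [:- z, 1:])"
  have fin: "finite (Zset0 m p :: 'a set)"
    using finite_Zset[OF p, of m] Suc by (simp add: Zset0_def)
  have degP: "degree P = card (Zset0 m p :: 'a set)"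
    unfolding P_def by (subst degree_prod_sum_eq) auto
  have F: "degree F = fib_deg p m" "lead_coeff F = 1"
    using fib_poly_monic[OF p2, of k, where 'a = 'a] Suc by (simp_all add: F_def)
  hence F0: "F \<noteq> 0" by auto
  have "degree P \<le> card {z. poly F z = 0}"
    unfolding degP F_def using poly_fib_poly_Zset0[OF p] poly_roots_finite[OF F0]
    by (intro card_mono) (auto simp: F_def)
  also have "\<dots> \<le> degree F" using F0 by (rule card_poly_roots_bound)
  \<comment> \<open>The lower bound on the number of values closes the chain of
    inequalities.\<close>
  finally have deg: "degree P = degree F"
    using card_Zset0_ge[OF p, of m] Suc by (simp add: degP F)
  have "P = F"
  proof (rule ccontr)
    \<comment> \<open>Both are monic of the same degree, so the difference has smaller degree and
      yet vanishes on all of \<open>Zset0 m p\<close>.\<close>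
    assume "P \<noteq> F"
    hence "P - F \<noteq> 0" by simp
    have "lead_coeff P = 1"
      unfolding P_def by (simp add: lead_coeff_prod)
    hence "coeff (P - F) (degree F) = 0"
      using F deg by simp
    moreover have "degree (P - F) \<le> degree F"
      using degree_diff_le_max[of P F] deg by simp
    ultimately have "degree (P - F) < degree F"
      using \<open>P - F \<noteq> 0\<close> by (metis leading_coeff_0_iff le_neq_implies_less)
    moreover have "card (Zset0 m p :: 'a set) \<le> card {z. poly (P - F) z = 0}"
      using poly_fib_poly_Zset0[OF p] poly_roots_finite[OF \<open>P - F \<noteq> 0\<close>] fin
      by (intro card_mono) (auto simp: F_def P_def poly_prod)
    moreover have "card {z. poly (P - F) z = 0} \<le> degree (P - F)"
      using \<open>P - F \<noteq> 0\<close> by (rule card_poly_roots_bound)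
    ultimately show False
      using deg degP by simp
  qed
  thus ?thesis
    using Suc by (simp add: fpoly_def P_def F_def)
qed (simp add: fpoly_def)

text \<open>Both polynomials are products of distinct linear factors. Once the factors over the
  common index set are split off, the remaining index sets are disjoint and the cofactors
  coprime.\<close>

lemma gcd_fpoly:
  assumes p: "prime p" "CHAR('a :: {alg_closed_field, field_gcd}) = p" and mn: "m \<ge> 1" "n \<ge> 1"
  shows "gcd (fpoly m p :: 'a poly) (fpoly n p) = fpoly (gcd m n) p"
proof -
  define A B C where "A = (Zset0 m p :: 'a set)" and "B = (Zset0 n p :: 'a set)"
    and "C = (Zset0 (gcd m n) p :: 'a set)"
  have C: "C = A \<inter> B"
    unfolding A_def B_def C_def by (rule Zset0_gcd[OF p, symmetric])
  have fin: "finite A" "finite B"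
    using finite_Zset[OF p] mn by (simp_all add: A_def B_def Zset0_def)
  define P where "P X = (\<Prod>z\<in>X. [:- z, 1:])" for X :: "'a set"
  have split: "P X = P C * P (X - C)" if "finite X" "C \<subseteq> X" for X
    unfolding P_def using prod.subset_diff[OF that(2,1)] by (simp add: mult.commute)
  have cop: "coprime [:- a, 1:] [:- b, 1:]" if "a \<noteq> b" for a b :: 'a
  proof (rule coprimeI)
    fix d assume "d dvd [:- a, 1:]" "d dvd [:- b, 1:]"
    hence "d dvd [:- a, 1:] - [:- b, 1:]" by (rule dvd_diff)
    moreover have "is_unit ([:- a, 1:] - [:- b, 1:])"
      using that by (simp add: is_unit_const_poly_iff dvd_field_iff)
    ultimately show "is_unit d" by (rule dvd_trans)
  qed
  have "coprime (P (A - C)) (P (B - C))"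
    unfolding P_def by (intro prod_coprime_left prod_coprime_right cop) (auto simp: C)
  moreover have "P A = P C * P (A - C)" "P B = P C * P (B - C)"
    by (rule split; use fin C in blast)+
  ultimately have "gcd (P A) (P B) = normalize (P C)"
    by (simp only: gcd_mult_left coprime_imp_gcd_eq_1 mult_1_right)
  also have "normalize (P C) = P C"
    by (simp add: normalize_poly_eq_map_poly P_def lead_coeff_prod)
  finally show ?thesis
    using mn by (simp add: fpoly_def P_def A_def B_def C_def)
qed

theorem theorem5p1:
  fixes p :: nat
  assumes "prime p"
    and "is_alg_closure_Fp TYPE('a :: {alg_closed_field, field_gcd}) p"
  shows "(\<forall>m\<ge>2. (fpoly m p :: 'a poly) =
              monom 1 (nat (theta (int m - 3) p)) * fpoly (m - 1) p + fpoly (m - 2) p) \<and>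
         (\<forall>m\<ge>1. (\<forall>i. coeff (fpoly m p :: 'a poly) i \<in> {0, 1}) \<and>
              (fpoly m p :: 'a poly) = (\<Sum>i\<in>exponents TYPE('a) m p. monom 1 i)) \<and>
         (\<forall>m\<ge>1. card (exponents TYPE('a) m p) = fib m) \<and>
         (\<forall>m\<ge>1. \<forall>n\<ge>1. gcd (fpoly m p :: 'a poly) (fpoly n p) = fpoly (gcd m n) p) \<and>
         (\<forall>m\<ge>1. odd m \<longrightarrow> (\<forall>i\<in>exponents TYPE('a) m p.
              \<forall>j. negabase_digits p (int i) j \<in> {0, 1})) \<and>
         (\<forall>m\<ge>2. even m \<longrightarrow> (\<forall>i\<in>exponents TYPE('a) m p.
              \<forall>j. negabase_digits p (- int i) j \<in> {0, 1})) \<and>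
         (\<forall>m\<ge>1. exponents TYPE('a) m p \<subseteq> exponents TYPE('a) (m + 2) p)"
proof -
  have p: "prime p" "CHAR('a) = p"
    using assms by (simp_all add: is_alg_closure_Fp_def)
  have p2: "p \<ge> 2" using p(1) by (rule prime_ge_2_nat)
  note eq = fpoly_eq_fib_poly[OF p]
  have S: "exponents TYPE('a) m p = {i. coeff (fib_poly p m :: 'a poly) i \<noteq> 0}" for m
    by (simp add: exponents_def eq)
  have rec: "(fpoly m p :: 'a poly) =
      monom 1 (nat (theta (int m - 3) p)) * fpoly (m - 1) p + fpoly (m - 2) p" if m: "m \<ge> 2" for m
  proof -
    obtain k where "m = 2 + k" using le_Suc_ex[OF m] by blast
    thus ?thesis unfolding eq by (simp add: fib_shift_def)
  qed
  have "(\<Sum>i\<in>exponents TYPE('a) m p. monom 1 i) = (fpoly m p :: 'a poly)" for m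
  proof (rule poly_eqI)
    fix j
    have "finite (exponents TYPE('a) m p)"
      using MOST_coeff_eq_0[of "fpoly m p :: 'a poly"]
      by (simp add: exponents_def eventually_cofinite)
    thus "coeff (\<Sum>i\<in>exponents TYPE('a) m p. monom 1 i) j = coeff (fpoly m p :: 'a poly) j"
      using coeff_fib_poly_in[OF p2, of m j, where 'a = 'a]
      by (auto simp: coeff_sum exponents_def eq)
  qed
  moreover have "negabase_digits p (int i) j \<in> {0, 1}"
    if m: "m \<ge> 1" "odd m" "i \<in> exponents TYPE('a) m p" for m i j
  proof -
    \<comment> \<open>The sign is +1 for odd \<open>m\<close>, so the sum represents i; for even
      \<open>m\<close> below it represents -i.\<close>
    obtain A where "A \<subseteq> {..<m - 2}" "(- 1) ^ Suc m * int i = (\<Sum>j\<in>A. (- int p) ^ j)"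
      using support_fib_poly_digits[OF p2 m(1), of i] m(3) unfolding S by auto
    thus ?thesis
      using m(2) by (intro negabase_digits_sum_powers[OF p2, of A]) (auto intro: finite_subset)
  qed
  moreover have "negabase_digits p (- int i) j \<in> {0, 1}"
    if m: "m \<ge> 2" "even m" "i \<in> exponents TYPE('a) m p" for m i j
  proof -
    obtain A where "A \<subseteq> {..<m - 2}" "(- 1) ^ Suc m * int i = (\<Sum>j\<in>A. (- int p) ^ j)"
      using support_fib_poly_digits[OF p2, of m i] m unfolding S by auto
    thus ?thesis
      using m(2) by (intro negabase_digits_sum_powers[OF p2, of A]) (auto intro: finite_subset)
  qed
  moreover have "exponents TYPE('a) m p \<subseteq> exponents TYPE('a) (m + 2) p" if "m \<ge> 1" for m
    unfolding S using support_fib_poly_rec(1)[OF p2 that, where 'a = 'a] by blast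
  moreover have "coeff (fpoly m p :: 'a poly) i \<in> {0, 1}" for m i
    unfolding eq by (rule coeff_fib_poly_in[OF p2])
  moreover have "card (exponents TYPE('a) m p) = fib m" for m
    unfolding S by (rule card_support_fib_poly[OF p2])
  ultimately show ?thesis
    using rec gcd_fpoly[OF p] by auto
qed

end
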